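(* Let $\mathbf X^{(1)},\mathbf X^{(2)},\dots$ be independent bivariate observations, each uniformly distributed in $(0,1)^2$, arriving at times $1,2,\dots$. Let $K_n=-1$ if the $n$th observation does not set a record, and otherwise let $K_n$ denote the number of remaining records (current records at time $n-1$) that are broken (killed) by the $n$th observation. Then, as $n\to\infty$, $K_n$, conditionally given $K_n\ge 0$, converges in distribution to $G-1$, where $G$ has the Geometric$(1/2)$ distribution; equivalently, for each fixed integer $k\ge 0$, $$\mathbb P(K_n=k\mid K_n\ge 0)\longrightarrow 2^{-(k+1)}\qquad (n\to\infty).$$
   Context: For $x=(x_1,x_2)$ and $y=(y_1,y_2)$ in $\mathbb R^2$, write $x\prec y$ if $x_1<y_1$ and $x_2<y_2$; $x\succ y$ means $y\prec x$. The observation $\mathbf X^{(n)}$ is a (Pareto) record, or sets a record at time $n$, if $\mathbf X^{(n)}\not\succ \mathbf X^{(i)}$ for all $1\le i<n$. For $1\le j\le n$, $\mathbf X^{(j)}$ is a current record (or remaining record) at time $n$ if $\mathbf X^{(j)}\not\succ\mathbf X^{(i)}$ for all $i\in\{1,\dots,n\}$. $\mathbf X^{(n)}$ breaks (kills) $k$ records if $\mathbf X^{(n)}$ sets a record and there are precisely $k$ values $j$ with $1\le j<n$ such that $\mathbf X^{(j)}$ is a current record at time $n-1$ but not at time $n$. The Geometric$(1/2)$ distribution is that with $\mathbb P(G=g)=2^{-g}$ for $g=1,2,\dots$. *)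

theory Defs
  imports "HOL-Probability.Probability"
begin

definition precedes :: "real \<times> real \<Rightarrow> real \<times> real \<Rightarrow> bool"  (infix "\<prec>" 50)
  where "x \<prec> y \<longleftrightarrow> fst x < fst y \<and> snd x < snd y"

text \<open>
  Below, \<open>x i\<close> is the observation arriving at time \<open>i \<ge> 1\<close>; the value \<open>x 0\<close> is never inspected.
\<close>

definition sets_record :: "(nat \<Rightarrow> real \<times> real) \<Rightarrow> nat \<Rightarrow> bool"
  where "sets_record x n \<longleftrightarrow> (\<forall>i. 1 \<le> i \<and> i < n \<longrightarrow> \<not> x i \<prec> x n)"

definition current_record :: "(nat \<Rightarrow> real \<times> real) \<Rightarrow> nat \<Rightarrow> nat \<Rightarrow> bool"
  where "current_record x n j \<longleftrightarrow> 1 \<le> j \<and> j \<le> n \<and> (\<forall>i\<in>{1..n}. \<not> x i \<prec> x j)"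

definition broken_records :: "(nat \<Rightarrow> real \<times> real) \<Rightarrow> nat \<Rightarrow> nat set"
  where "broken_records x n =
    {j. 1 \<le> j \<and> j < n \<and> current_record x (n - 1) j \<and> \<not> current_record x n j}"

definition record_breaks :: "(nat \<Rightarrow> real \<times> real) \<Rightarrow> nat \<Rightarrow> int"
  where "record_breaks x n = (if sets_record x n then int (card (broken_records x n)) else -1)"

text \<open>
  The library's \<^const>\<open>geometric_pmf\<close> is supported on \<open>{0, 1, \<dots>}\<close>, so it is shifted to obtain
  the Geometric(1/2) law on \<open>{1, 2, \<dots>}\<close>.
\<close>

definition geometric_half :: "nat pmf"
  where "geometric_half = map_pmf Suc (geometric_pmf (1/2))"

lemma pmf_geometric_half:
  "pmf geometric_half g = (if g \<ge> 1 then 1 / 2 ^ g else 0)"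
proof (cases g)
  case 0
  have "0 \<notin> set_pmf geometric_half"
    by (auto simp: geometric_half_def)
  then show ?thesis
    using 0 by (simp add: pmf_eq_0_set_pmf)
next
  case (Suc m)
  have "pmf geometric_half (Suc m) = pmf (geometric_pmf (1/2)) m"
    unfolding geometric_half_def by (rule pmf_map_inj') simp
  then show ?thesis
    using Suc by (simp add: power_one_over)
qed

end

theory Submission
  imports Defs
begin

text \<open>
  Only the relative order of the abscissae and the relative order of the ordinates matter. Since
  all coordinates are independent and, almost surely, distinct, the joint law does not change when
  the abscissae and the ordinates are permuted independently of each other. Averaging over all these
  permutations, and over which observation plays the part of the last one, turns
  \<open>n \<cdot> P(n sets a record and breaks k records)\<close> into a purely combinatorial quantity: the average,
  over all matchings of \<open>n\<close> abscissae with \<open>n\<close> ordinates, of the number of undominated points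
  \<open>p\<close> of the resulting configuration for which exactly \<open>k\<close> of the points above and to the right
  of \<open>p\<close> are undominated once \<open>p\<close> is left out (\<open>measure_record_event\<close>).

  The average is computed by adding points from left to right. A new rightmost point \<open>q\<close> precedes
  no other point in the order \<open>\<prec>\<close>, and it is dominated by exactly the points below it. If \<open>q\<close> is the
  lowest point, then it is a new undominated point and kills nothing. If \<open>q\<close> is the second lowest,
  then exactly the lowest point gains one kill. If at least two points lie below \<open>q\<close>, then
  nothing changes. The three cases have probabilities \<open>1/(i+1)\<close>, \<open>1/(i+1)\<close> and \<open>(i-1)/(i+1)\<close>
  when \<open>q\<close> is point number \<open>i+1\<close>. So, as points are added, the kill count of the current lowest
  point goes up or is frozen for ever with equal chances, which is the source of the law
  Geometric(1/2).

  Write \<open>R n g\<close> and \<open>L n g\<close> for the average of \<open>g(number of kills)\<close> summed over all undominated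
  points, and taken at the lowest point, respectively; here \<open>g\<close> is a test function. The case
  distinction gives linear recursions for \<open>R\<close> and \<open>L\<close> (\<open>sums_over_configurations\<close>). For \<open>g = 1\<close> the
  recursion yields the harmonic number, \<open>R n 1 = H n\<close>. For the indicator \<open>g\<close> of \<open>{k}\<close>, Stein's
  method applies: the equation \<open>h(l+1) = 2 h(l) - g(l)\<close> has the bounded solution
  \<open>h(l) = 2^-(k-l+1)\<close> for \<open>l \<le> k\<close> and \<open>h(l) = 0\<close> for \<open>l > k\<close>, and with it
  \<open>R n g - L n g + L n h\<close> grows by exactly \<open>h(0)/(n+1)\<close> in each step. Hence \<open>R n g\<close>
  differs from \<open>2^-(k+1) H n\<close> by at most 1 (\<open>record_avg_point\<close>), and the conditional probability
  \<open>R n g / H n\<close> tends to \<open>2^-(k+1)\<close>. As every distribution function at \<open>x\<close> involves only the finitely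
  many values \<open>k \<le> x\<close>, the convergence in distribution follows.
\<close>

section \<open>Adding a rightmost point to a configuration\<close>

no_notation lesspoll (infixl "\<prec>" 50)

definition undominated :: "(real \<times> real) set \<Rightarrow> real \<times> real \<Rightarrow> bool"
  where "undominated P p \<longleftrightarrow> (\<forall>q\<in>P. \<not> q \<prec> p)"

definition lowest :: "(real \<times> real) set \<Rightarrow> real \<times> real \<Rightarrow> bool"
  where "lowest P p \<longleftrightarrow> (\<forall>q\<in>P. snd p \<le> snd q)"

definition kills :: "(real \<times> real) set \<Rightarrow> real \<times> real \<Rightarrow> nat"
  where "kills P p = card {q\<in>P. p \<prec> q \<and> undominated (P - {p}) q}"

definition record_sum :: "(nat \<Rightarrow> real) \<Rightarrow> (real \<times> real) set \<Rightarrow> real"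
  where "record_sum g P = (\<Sum>p | p \<in> P \<and> undominated P p. g (kills P p))"

text \<open>
  In a nonempty configuration with distinct ordinates this sum has a single term. Writing it as a sum
  gives the empty configuration the value 0.
\<close>
definition lowest_sum :: "(nat \<Rightarrow> real) \<Rightarrow> (real \<times> real) set \<Rightarrow> real"
  where "lowest_sum g P = (\<Sum>p | p \<in> P \<and> lowest P p. g (kills P p))"

text \<open>
  Points are added in the order of their abscissae, so that a point never dominates an earlier one.
  Hence all changes are governed by the height of the new point alone.
\<close>
locale rightmost_point =
  fixes P :: "(real \<times> real) set" and q :: "real \<times> real"
  assumes finite_P: "finite P"
    and right: "\<And>p. p \<in> P \<Longrightarrow> fst p < fst q"
    and inj_snd: "inj_on snd (insert q P)"
begin

lemma q_notin: "q \<notin> P"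
  using right by blast

lemma snd_neq: "p \<in> P \<Longrightarrow> snd p \<noteq> snd q"
  using inj_snd q_notin unfolding inj_on_def by auto

lemma undominated_insert: "p \<in> P \<Longrightarrow> undominated (insert q P) p \<longleftrightarrow> undominated P p"
  using right[of p] by (auto simp: undominated_def precedes_def)

lemma undominated_new:
  assumes "Q \<subseteq> P" shows "undominated (insert q Q) q \<longleftrightarrow> (\<forall>p\<in>Q. snd q < snd p)"
proof -
  have "\<not> p \<prec> q \<longleftrightarrow> snd q < snd p" if "p \<in> P" for p
    using right[OF that] snd_neq[OF that] by (auto simp: precedes_def)
  moreover have "\<not> q \<prec> q" by (simp add: precedes_def)
  ultimately show ?thesis using assms unfolding undominated_def by blast
qed

lemma kills_new: "kills (insert q P) q = 0"
proof -
  have "\<not> q \<prec> r" if "r \<in> insert q P" for r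
    using right[of r] that by (auto simp: precedes_def)
  hence none: "{r \<in> insert q P. q \<prec> r \<and> undominated (insert q P - {q}) r} = {}"
    by blast
  show ?thesis unfolding kills_def none by simp
qed

text \<open>
  The new point is killed by \<open>p\<close> exactly if \<open>p\<close> is the only point below it: a second lower point
  would dominate it even after \<open>p\<close> is left out.
\<close>
lemma kills_insert:
  assumes "p \<in> P"
  shows "kills (insert q P) p =
    kills P p + (if snd p < snd q \<and> (\<forall>r\<in>P - {p}. snd q < snd r) then 1 else 0)"
proof -
  define C where "C \<longleftrightarrow> snd p < snd q \<and> (\<forall>r\<in>P - {p}. snd q < snd r)"
  have neq: "q \<noteq> p" using assms q_notin by blast
  have und: "undominated (insert q P - {p}) r \<longleftrightarrow> undominated (P - {p}) r" if "r \<in> P" for r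
    using right[OF that] by (auto simp: undominated_def precedes_def)
  have und_q: "undominated (insert q P - {p}) q \<longleftrightarrow> (\<forall>r\<in>P - {p}. snd q < snd r)"
    using undominated_new[of "P - {p}"] neq by (simp add: insert_Diff_if)
  have prec: "p \<prec> q \<longleftrightarrow> snd p < snd q"
    using right[OF assms] by (simp add: precedes_def)
  have "{r \<in> insert q P. p \<prec> r \<and> undominated (insert q P - {p}) r} =
    {r \<in> P. p \<prec> r \<and> undominated (P - {p}) r} \<union> (if C then {q} else {})" (is "_ = ?A \<union> _")
    using und und_q prec by (cases C) (auto simp: C_def)
  hence "kills (insert q P) p = card (?A \<union> (if C then {q} else {}))"
    unfolding kills_def by (rule arg_cong)
  moreover have "card (?A \<union> {q}) = card ?A + 1"
    using q_notin finite_P by simp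
  ultimately show ?thesis
    unfolding kills_def C_def[symmetric]
    by (cases C) (simp_all only: if_True if_False Un_empty_right add_0_right)
qed

lemma sums_insert_lowest:
  assumes low: "\<And>p. p \<in> P \<Longrightarrow> snd q < snd p"
  shows "record_sum g (insert q P) = record_sum g P + g 0"
    and "lowest_sum g (insert q P) = g 0"
proof -
  have k: "kills (insert q P) p = kills P p" if "p \<in> P" for p
    using kills_insert[OF that] low[OF that] by simp
  have "{p. p \<in> insert q P \<and> undominated (insert q P) p} = insert q {p. p \<in> P \<and> undominated P p}"
    using undominated_insert undominated_new[of P] low by blast
  thus "record_sum g (insert q P) = record_sum g P + g 0"
    unfolding record_sum_def using q_notin finite_P k kills_new by (simp add: sum.insert_if)
  have "\<not> lowest (insert q P) p" if "p \<in> P" for p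
    using low[OF that] by (auto simp: lowest_def not_le)
  moreover have "lowest (insert q P) q"
    using low by (auto simp: lowest_def less_imp_le)
  ultimately have lowest: "{p. p \<in> insert q P \<and> lowest (insert q P) p} = {q}"
    by blast
  show "lowest_sum g (insert q P) = g 0"
    unfolding lowest_sum_def lowest using kills_new by simp
qed

lemma sums_insert_second_lowest:
  assumes p: "p \<in> P" "snd p < snd q" and above: "\<And>r. r \<in> P - {p} \<Longrightarrow> snd q < snd r"
  shows "record_sum g (insert q P) = record_sum g P - lowest_sum g P + lowest_sum (g \<circ> Suc) P"
    and "lowest_sum g (insert q P) = lowest_sum (g \<circ> Suc) P"
proof -
  have k: "kills (insert q P) r = kills P r" if "r \<in> P - {p}" for r
  proof -
    have "\<not> snd r < snd q" using above[OF that] by simp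
    thus ?thesis using kills_insert[of r] that by simp
  qed
  have "\<forall>r\<in>P - {p}. snd q < snd r"
    using above by blast
  hence kp: "kills (insert q P) p = Suc (kills P p)"
    using kills_insert[OF p(1)] p(2) by simp
  have below: "snd p < snd r" if "r \<in> insert q P - {p}" for r
    using that p(2) above[of r] by (cases "r = q") auto
  have "snd p \<le> snd r" if "r \<in> insert q P" for r
    using below[of r] that by (cases "r = p") auto
  hence "lowest (insert q P) p" "lowest P p"
    unfolding lowest_def by blast+
  moreover have "\<not> lowest P r" "\<not> lowest (insert q P) r" if "r \<in> insert q P - {p}" for r
    using below[OF that] p(1) by (auto simp: lowest_def not_le)
  ultimately have low: "{r. r \<in> P \<and> lowest P r} = {p}"
      "{r. r \<in> insert q P \<and> lowest (insert q P) r} = {p}"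
    using p(1) by blast+
  show l: "lowest_sum g (insert q P) = lowest_sum (g \<circ> Suc) P"
    unfolding lowest_sum_def low by (simp add: kp)
  have "\<not> r \<prec> p" if "r \<in> P" for r
    using below[of r] that by (cases "r = p") (auto simp: precedes_def)
  hence und: "undominated P p"
    unfolding undominated_def by blast
  have "\<not> undominated (insert q P) q"
    using undominated_new[of P] p by (meson less_asym order_refl)
  hence eq: "{r. r \<in> insert q P \<and> undominated (insert q P) r} = {r. r \<in> P \<and> undominated P r}"
    using undominated_insert by blast
  have split: "sum f {r. r \<in> P \<and> undominated P r} = f p + sum f {r. r \<in> P - {p} \<and> undominated P r}"
    for f :: "real \<times> real \<Rightarrow> real"
  proof -
    have "{r. r \<in> P \<and> undominated P r} = insert p {r. r \<in> P - {p} \<and> undominated P r}"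
      using p und by blast
    thus ?thesis using finite_P by simp
  qed
  show "record_sum g (insert q P) = record_sum g P - lowest_sum g P + lowest_sum (g \<circ> Suc) P"
    unfolding record_sum_def lowest_sum_def eq split low by (simp add: k kp)
qed

lemma sums_insert_higher:
  assumes p: "p \<in> P" "snd p < snd q" and r: "r \<in> P" "snd r < snd q" and "p \<noteq> r"
  shows "record_sum g (insert q P) = record_sum g P"
    and "lowest_sum g (insert q P) = lowest_sum g P"
proof -
  have k: "kills (insert q P) s = kills P s" if "s \<in> P" for s
  proof -
    have "\<not> (\<forall>t\<in>P - {s}. snd q < snd t)"
      using p r \<open>p \<noteq> r\<close> by (metis DiffI less_asym singletonD)
    thus ?thesis using kills_insert[OF that] by simp
  qed
  have und: "{r. r \<in> insert q P \<and> undominated (insert q P) r} = {r. r \<in> P \<and> undominated P r}"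
  proof -
    have "\<not> undominated (insert q P) q"
      using undominated_new[of P] p by (meson less_asym order_refl)
    thus ?thesis using undominated_insert by blast
  qed
  show "record_sum g (insert q P) = record_sum g P"
    unfolding record_sum_def und by (intro sum.cong refl) (simp add: k)
  have "lowest (insert q P) s \<longleftrightarrow> lowest P s" if "s \<in> P" for s
  proof -
    have "snd s \<le> snd q" if "snd s \<le> snd p" using that p(2) by simp
    thus ?thesis using p(1) unfolding lowest_def by blast
  qed
  moreover have "\<not> lowest (insert q P) q"
    using p by (auto simp: lowest_def not_le)
  ultimately have low: "{r. r \<in> insert q P \<and> lowest (insert q P) r} = {r. r \<in> P \<and> lowest P r}"
    by blast
  show "lowest_sum g (insert q P) = lowest_sum g P"
    unfolding lowest_sum_def low by (intro sum.cong refl) (simp add: k)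
qed

end

section \<open>Averages over all matchings of abscissae and ordinates\<close>

text \<open>
  Of the \<open>i + 1\<close> equally likely heights of a new rightmost point, one makes it the lowest point, one
  makes it the second lowest, and \<open>i - 1\<close> make it higher. For \<open>i = 0\<close> the coefficient \<open>i - 1\<close> is
  negative and there is no second lowest height, but then the factors \<open>lowest_avg 0\<close> vanish and the
  formula stays right.
\<close>
primrec lowest_avg :: "nat \<Rightarrow> (nat \<Rightarrow> real) \<Rightarrow> real" where
  "lowest_avg 0 g = 0"
| "lowest_avg (Suc i) g =
     (g 0 + lowest_avg i (g \<circ> Suc) + (real i - 1) * lowest_avg i g) / real (Suc i)"

text \<open>
  A new lowest point adds \<open>g 0\<close>; a new second lowest point replaces the contribution
  \<open>g m\<close> of the lowest point by \<open>g (m + 1)\<close>, where \<open>m\<close> is its number of kills.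
\<close>
primrec record_avg :: "nat \<Rightarrow> (nat \<Rightarrow> real) \<Rightarrow> real" where
  "record_avg 0 g = 0"
| "record_avg (Suc i) g =
     record_avg i g + (g 0 + lowest_avg i (g \<circ> Suc) - lowest_avg i g) / real (Suc i)"

lemma sum_permutations_Cons:
  assumes "finite B" "B \<noteq> {}"
  shows "(\<Sum>ys\<in>permutations_of_set B. f ys) =
    (\<Sum>y\<in>B. \<Sum>ys\<in>permutations_of_set (B - {y}). (f (y # ys) :: real))"
proof -
  have "(\<Sum>ys\<in>permutations_of_set B. f ys) =
      (\<Sum>y\<in>B. \<Sum>ys\<in>(#) y ` permutations_of_set (B - {y}). f ys)"
    unfolding permutations_of_set_nonempty[OF assms(2)]
    using assms(1) by (intro sum.UNION_disjoint) auto
  also have "\<dots> = (\<Sum>y\<in>B. \<Sum>ys\<in>permutations_of_set (B - {y}). f (y # ys))"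
    by (intro sum.cong[OF refl]) (simp add: sum.reindex inj_on_def)
  finally show ?thesis .
qed

text \<open>
  The form in which the case distinction on the height of the new point enters the sum over all
  heights.
\<close>
lemma sum_two_smallest:
  fixes B :: "real set" and f :: "real \<Rightarrow> real"
  assumes "finite B" "card B = Suc (Suc i)"
    and low: "\<And>y. y \<in> B \<Longrightarrow> \<forall>z\<in>B - {y}. y < z \<Longrightarrow> f y = c"
    and second: "\<And>y z. y \<in> B \<Longrightarrow> z \<in> B \<Longrightarrow> z < y \<Longrightarrow> \<forall>w\<in>B - {y, z}. y < w \<Longrightarrow> f y = d"
    and rest: "\<And>y z w. y \<in> B \<Longrightarrow> z \<in> B \<Longrightarrow> w \<in> B \<Longrightarrow> z \<noteq> w \<Longrightarrow> z < y \<Longrightarrow> w < y \<Longrightarrow> f y = e"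
  shows "sum f B = c + d + real i * e"
proof -
  define m where "m = Min B"
  have B: "B \<noteq> {}" using assms by auto
  have m: "m \<in> B" "\<forall>z\<in>B - {m}. m < z"
    using B assms(1) by (auto simp: m_def) (metis Min_le order_less_le)
  define s where "s = Min (B - {m})"
  have cm: "card (B - {m}) = Suc i" using assms m by simp
  hence B': "B - {m} \<noteq> {}" by (metis card.empty nat.distinct(1))
  have s: "s \<in> B - {m}" "\<forall>z\<in>B - {m, s}. s < z"
    using Min_in[OF _ B'] Min_le[of "B - {m}"] assms(1)
    by (auto simp: s_def order_less_le)
  have cs: "card (B - {m} - {s}) = i" using cm s(1) assms(1) by simp
  have "sum f B = f m + (f s + sum f (B - {m} - {s}))"
    using m(1) s(1) assms(1) by (metis finite_Diff sum.remove)
  also have "sum f (B - {m} - {s}) = (\<Sum>y\<in>B - {m} - {s}. e)"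
    using m s by (intro sum.cong refl rest[of _ m s]) auto
  also have "f m = c" using low m by blast
  also have "f s = d" using second[of s m] s m by (auto simp: insert_commute)
  finally show ?thesis using cs by simp
qed

text \<open>
  A matching of the abscissae \<open>xs\<close> with the ordinates \<open>B\<close> is an enumeration \<open>ys\<close> of \<open>B\<close>. Since \<open>xs\<close> is
  decreasing, its head is the rightmost point, and fixing the ordinate \<open>y\<close> of that point leaves
  a matching of the remaining abscissae with \<open>B - {y}\<close>. That the result depends on \<open>xs\<close> and
  \<open>B\<close> only through their size makes the induction work.
\<close>
lemma sums_over_configurations:
  fixes B :: "real set"
  assumes "sorted_wrt (>) xs" "finite B" "card B = length xs"
  shows "(\<Sum>ys\<in>permutations_of_set B. record_sum g (set (zip xs ys))) = fact (length xs) * record_avg (length xs) g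
    \<and> (\<Sum>ys\<in>permutations_of_set B. lowest_sum g (set (zip xs ys))) = fact (length xs) * lowest_avg (length xs) g"
  using assms
proof (induction xs arbitrary: B g)
  case Nil
  then show ?case by (simp add: record_sum_def lowest_sum_def)
next
  case (Cons x xs)
  let ?n = "length xs"
  let ?R = "\<lambda>y ys. record_sum g (set (zip (x # xs) (y # ys)))"
  let ?L = "\<lambda>y ys. lowest_sum g (set (zip (x # xs) (y # ys)))"
  have B: "B \<noteq> {}" using Cons.prems by auto
  have IH: "(\<Sum>ys\<in>permutations_of_set (B - {y}). record_sum g (set (zip xs ys))) = fact ?n * record_avg ?n g"
    "(\<Sum>ys\<in>permutations_of_set (B - {y}). lowest_sum g (set (zip xs ys))) = fact ?n * lowest_avg ?n g"
    if "y \<in> B" for y g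
    using Cons.IH[of "B - {y}" g] Cons.prems that by auto
  have card_perms: "card (permutations_of_set (B - {y})) = fact ?n" if "y \<in> B" for y
    using Cons.prems that by simp
  have rp: "rightmost_point (set (zip xs ys)) (x, y)"
    and snds: "snd ` set (zip xs ys) = B - {y}"
    if y: "y \<in> B" and ys: "ys \<in> permutations_of_set (B - {y})" for y ys
  proof -
    have *: "set ys = B - {y}" "distinct ys" using ys by (auto simp: permutations_of_set_def)
    have len: "length ys = length xs"
      using * Cons.prems y by (metis distinct_card card_Diff_singleton diff_Suc_1 length_Cons)
    show snds: "snd ` set (zip xs ys) = B - {y}"
      using len * by (metis list.set_map map_snd_zip)
    have "distinct (map snd (zip xs ys))" using len * by simp
    hence "inj_on snd (set (zip xs ys))" by (simp add: distinct_map)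
    moreover have "y \<notin> snd ` set (zip xs ys)" using snds by simp
    ultimately show "rightmost_point (set (zip xs ys)) (x, y)"
      using Cons.prems(1) by unfold_locales (auto dest: set_zip_leftD)
  qed
  have low: "(\<Sum>ys\<in>permutations_of_set (B - {y}). ?R y ys) = fact ?n * (record_avg ?n g + g 0)"
     "(\<Sum>ys\<in>permutations_of_set (B - {y}). ?L y ys) = fact ?n * g 0"
    if y: "y \<in> B" "\<forall>z\<in>B - {y}. y < z" for y
  proof -
    have eq: "?R y ys = record_sum g (set (zip xs ys)) + g 0 \<and> ?L y ys = g 0"
      if "ys \<in> permutations_of_set (B - {y})" for ys
      using rightmost_point.sums_insert_lowest[OF rp[OF y(1) that], of g] y(2)
      unfolding snds[OF y(1) that, symmetric] by simp
    show "(\<Sum>ys\<in>permutations_of_set (B - {y}). ?R y ys) = fact ?n * (record_avg ?n g + g 0)"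
      using eq by (simp add: sum.distrib IH[OF y(1)] card_perms[OF y(1)] distrib_left del: zip_Cons_Cons)
    show "(\<Sum>ys\<in>permutations_of_set (B - {y}). ?L y ys) = fact ?n * g 0"
      using eq by (simp add: card_perms[OF y(1)] del: zip_Cons_Cons)
  qed
  have second: "(\<Sum>ys\<in>permutations_of_set (B - {y}). ?R y ys) =
      fact ?n * (record_avg ?n g - lowest_avg ?n g + lowest_avg ?n (g \<circ> Suc))"
     "(\<Sum>ys\<in>permutations_of_set (B - {y}). ?L y ys) = fact ?n * lowest_avg ?n (g \<circ> Suc)"
    if y: "y \<in> B" "z \<in> B" "z < y" "\<forall>w\<in>B - {y, z}. y < w" for y z
  proof -
    have eq: "?R y ys = record_sum g (set (zip xs ys)) - lowest_sum g (set (zip xs ys))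
         + lowest_sum (g \<circ> Suc) (set (zip xs ys))
       \<and> ?L y ys = lowest_sum (g \<circ> Suc) (set (zip xs ys))"
      if ys: "ys \<in> permutations_of_set (B - {y})" for ys
    proof -
      let ?P = "set (zip xs ys)"
      have "z \<in> snd ` ?P" using y snds[OF y(1) ys] by auto
      then obtain p where p: "p \<in> ?P" "snd p = z" by blast
      have "snd r \<noteq> z" if "r \<in> ?P - {p}" for r
        using rightmost_point.inj_snd[OF rp[OF y(1) ys]] p that by (auto simp: inj_on_def)
      hence "y < snd r" if "r \<in> ?P - {p}" for r
        using y(4) snds[OF y(1) ys] that by blast
      thus ?thesis
        using rightmost_point.sums_insert_second_lowest[OF rp[OF y(1) ys] p(1), of g] p y(3) by simp
    qed
    show "(\<Sum>ys\<in>permutations_of_set (B - {y}). ?R y ys) =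
      fact ?n * (record_avg ?n g - lowest_avg ?n g + lowest_avg ?n (g \<circ> Suc))"
    proof -
      have "(\<Sum>ys\<in>permutations_of_set (B - {y}). ?R y ys) =
          (\<Sum>ys\<in>permutations_of_set (B - {y}). record_sum g (set (zip xs ys))
            - lowest_sum g (set (zip xs ys)) + lowest_sum (g \<circ> Suc) (set (zip xs ys)))"
        using eq by (intro sum.cong) blast+
      also have "\<dots> = fact ?n * record_avg ?n g - fact ?n * lowest_avg ?n g
          + fact ?n * lowest_avg ?n (g \<circ> Suc)"
        by (simp only: sum.distrib sum_subtractf IH[OF y(1)])
      finally show ?thesis by (simp only: distrib_left right_diff_distrib)
    qed
    show "(\<Sum>ys\<in>permutations_of_set (B - {y}). ?L y ys) = fact ?n * lowest_avg ?n (g \<circ> Suc)"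
      using eq by (simp add: IH[OF y(1)] del: zip_Cons_Cons)
  qed
  have higher: "(\<Sum>ys\<in>permutations_of_set (B - {y}). ?R y ys) = fact ?n * record_avg ?n g"
     "(\<Sum>ys\<in>permutations_of_set (B - {y}). ?L y ys) = fact ?n * lowest_avg ?n g"
    if y: "y \<in> B" "z \<in> B" "w \<in> B" "z \<noteq> w" "z < y" "w < y" for y z w
  proof -
    have eq: "?R y ys = record_sum g (set (zip xs ys)) \<and> ?L y ys = lowest_sum g (set (zip xs ys))"
      if ys: "ys \<in> permutations_of_set (B - {y})" for ys
    proof -
      let ?P = "set (zip xs ys)"
      have "z \<in> snd ` ?P" "w \<in> snd ` ?P" using y snds[OF y(1) ys] by auto
      then obtain p r where p: "p \<in> ?P" "snd p = z" "r \<in> ?P" "snd r = w" by blast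
      thus ?thesis
        using rightmost_point.sums_insert_higher[OF rp[OF y(1) ys] p(1) _ p(3), of g] y by auto
    qed
    show "(\<Sum>ys\<in>permutations_of_set (B - {y}). ?R y ys) = fact ?n * record_avg ?n g"
      using eq by (simp add: IH[OF y(1)] del: zip_Cons_Cons)
    show "(\<Sum>ys\<in>permutations_of_set (B - {y}). ?L y ys) = fact ?n * lowest_avg ?n g"
      using eq by (simp add: IH[OF y(1)] del: zip_Cons_Cons)
  qed
  show ?case
  proof (cases ?n)
    case 0
    then obtain b where b: "B = {b}"
      using Cons.prems by (auto simp: card_1_singleton_iff)
    show ?thesis
      unfolding sum_permutations_Cons[OF Cons.prems(2) B]
      using low[of b] 0 by (simp add: b)
  next
    case (Suc i)
    have card: "card B = Suc (Suc i)" using Cons.prems Suc by simp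
    define N where "N = real (Suc ?n)"
    have N: "N \<noteq> 0" "real i = N - 2" "fact (length (x # xs)) = N * (fact ?n :: real)"
      "record_avg (length (x # xs)) g =
        record_avg ?n g + (g 0 + lowest_avg ?n (g \<circ> Suc) - lowest_avg ?n g) / N"
      "lowest_avg (length (x # xs)) g =
        (g 0 + lowest_avg ?n (g \<circ> Suc) + (N - 2) * lowest_avg ?n g) / N"
      using Suc by (simp_all add: N_def)
    have "(\<Sum>ys\<in>permutations_of_set B. record_sum g (set (zip (x # xs) ys))) =
        fact ?n * (record_avg ?n g + g 0)
      + fact ?n * (record_avg ?n g - lowest_avg ?n g + lowest_avg ?n (g \<circ> Suc))
      + real i * (fact ?n * record_avg ?n g)"
      unfolding sum_permutations_Cons[OF Cons.prems(2) B]
      by (rule sum_two_smallest[OF Cons.prems(2) card]) (fact low second higher)+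
    also have "\<dots> = fact (length (x # xs)) * record_avg (length (x # xs)) g"
      unfolding N(2-5) using N(1) by (simp add: field_simps)
    finally have R: "(\<Sum>ys\<in>permutations_of_set B. record_sum g (set (zip (x # xs) ys))) = \<dots>" .
    have "(\<Sum>ys\<in>permutations_of_set B. lowest_sum g (set (zip (x # xs) ys))) =
        fact ?n * g 0 + fact ?n * lowest_avg ?n (g \<circ> Suc) + real i * (fact ?n * lowest_avg ?n g)"
      unfolding sum_permutations_Cons[OF Cons.prems(2) B]
      by (rule sum_two_smallest[OF Cons.prems(2) card]) (fact low second higher)+
    also have "\<dots> = fact (length (x # xs)) * lowest_avg (length (x # xs)) g"
      unfolding N(2-5) using N(1) by (simp add: field_simps)
    finally show ?thesis using R by blast
  qed
qed

section \<open>Asymptotics of the averages\<close>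

lemma record_avg_one: "record_avg n (\<lambda>_. 1) = harm n"
proof -
  have "(\<lambda>_. 1 :: real) \<circ> Suc = (\<lambda>_. 1)" by auto
  thus ?thesis by (induction n) (simp_all add: harm_Suc harm_expand inverse_eq_divide)
qed

lemma lowest_avg_linear:
  "lowest_avg n (\<lambda>l. a * f l - b * g l) = a * lowest_avg n f - b * lowest_avg n g"
proof (induction n arbitrary: f g)
  case (Suc n)
  have "(\<lambda>l. a * f l - b * g l) \<circ> Suc = (\<lambda>l. a * (f \<circ> Suc) l - b * (g \<circ> Suc) l)" by auto
  hence shift: "lowest_avg n ((\<lambda>l. a * f l - b * g l) \<circ> Suc) =
      a * lowest_avg n (f \<circ> Suc) - b * lowest_avg n (g \<circ> Suc)"
    by (simp only: Suc.IH)
  thus ?case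
    unfolding lowest_avg.simps Suc.IH shift by (simp add: diff_divide_distrib add_divide_distrib algebra_simps)
qed simp

lemma record_avg_linear:
  "record_avg n (\<lambda>l. a * f l - b * g l) = a * record_avg n f - b * record_avg n g"
proof (induction n)
  case (Suc n)
  have "(\<lambda>l. a * f l - b * g l) \<circ> Suc = (\<lambda>l. a * (f \<circ> Suc) l - b * (g \<circ> Suc) l)" by auto
  hence shift: "lowest_avg n ((\<lambda>l. a * f l - b * g l) \<circ> Suc) =
      a * lowest_avg n (f \<circ> Suc) - b * lowest_avg n (g \<circ> Suc)"
    by (simp only: lowest_avg_linear)
  show ?case
    unfolding record_avg.simps Suc.IH shift lowest_avg_linear
    by (simp add: diff_divide_distrib add_divide_distrib algebra_simps)
qed simp

lemma lowest_avg_bounds: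
  assumes "\<And>l. 0 \<le> g l" "\<And>l. g l \<le> 1"
  shows "0 \<le> lowest_avg n g \<and> lowest_avg n g \<le> 1"
  using assms
proof (induction n arbitrary: g)
  case (Suc n)
  have IH: "0 \<le> lowest_avg n g \<and> lowest_avg n g \<le> 1" "0 \<le> lowest_avg n (g \<circ> Suc) \<and> lowest_avg n (g \<circ> Suc) \<le> 1"
    using Suc by simp_all
  show ?case
  proof (cases n)
    case 0
    then show ?thesis using Suc.prems[of 0] by simp
  next
    case (Suc m)
    hence "0 \<le> real n - 1" by simp
    hence "0 \<le> (real n - 1) * lowest_avg n g" "(real n - 1) * lowest_avg n g \<le> (real n - 1) * 1"
      using IH(1) by (blast intro: mult_nonneg_nonneg mult_left_mono)+
    moreover have "0 \<le> g 0" "g 0 \<le> 1" by (fact Suc.prems)+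
    ultimately show ?thesis
      using IH(2) unfolding lowest_avg.simps by (simp del: of_nat_Suc)
  qed
qed simp

text \<open>
  Stein's method. Applying the recursion of \<open>lowest_avg\<close> to the solution \<open>h\<close> of
  \<open>h (l + 1) = 2 * h l - g l\<close> turns the increments of \<open>record_avg n g - lowest_avg n g\<close>, which are
  \<open>lowest_avg n g / (n + 1)\<close>, into a telescoping part and the constant multiple \<open>h 0\<close> of the harmonic
  increments. All error terms are values of \<open>lowest_avg\<close> at functions between 0 and 1.
\<close>
lemma record_avg_point:
  "\<bar>record_avg n (indicat_real {k}) - harm n / 2 ^ (k + 1)\<bar> \<le> 1"
proof -
  define g :: "nat \<Rightarrow> real" where "g = indicat_real {k}"
  define h :: "nat \<Rightarrow> real" where "h = (\<lambda>l. if l \<le> k then 1 / 2 ^ (k - l + 1) else 0)"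
  have stein: "h \<circ> Suc = (\<lambda>l. 2 * h l - 1 * g l)"
  proof
    fix l
    show "(h \<circ> Suc) l = 2 * h l - 1 * g l"
    proof (cases "l < k")
      case True
      hence "k - l = Suc (k - Suc l)" by simp
      thus ?thesis using True by (simp add: g_def h_def)
    qed (auto simp: g_def h_def)
  qed
  have h0: "h 0 = 1 / 2 ^ (k + 1)" by (simp add: h_def)
  have inv: "record_avg n g - lowest_avg n g + lowest_avg n h = harm n / 2 ^ (k + 1)"
  proof (induction n)
    case (Suc n)
    have L: "lowest_avg n (h \<circ> Suc) = 2 * lowest_avg n h - lowest_avg n g"
      unfolding stein lowest_avg_linear by simp
    have step: "record_avg (Suc n) g - lowest_avg (Suc n) g + lowest_avg (Suc n) h =
      record_avg n g - lowest_avg n g + lowest_avg n h + h 0 / real (Suc n)"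
    proof -
      define N where "N = real (Suc n)"
      have N: "N \<noteq> 0" "real n = N - 1" by (simp_all add: N_def)
      show ?thesis
        unfolding record_avg.simps lowest_avg.simps L N_def[symmetric] N(2)
        using N(1) by (simp add: field_simps)
    qed
    show ?case
      unfolding step Suc.IH h0 harm_Suc by (simp add: add_divide_distrib inverse_eq_divide)
  qed (simp add: harm_expand)
  have "1 / 2 ^ m \<le> (1 :: real)" for m :: nat
    by (simp add: divide_le_eq_1 one_le_power)
  hence h: "0 \<le> h l" "h l \<le> 1" for l
    unfolding h_def by (simp_all only: split: if_split) simp_all
  have "0 \<le> lowest_avg n g \<and> lowest_avg n g \<le> 1"
    by (rule lowest_avg_bounds) (simp_all add: g_def)
  moreover have "0 \<le> lowest_avg n h \<and> lowest_avg n h \<le> 1"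
    using h by (rule lowest_avg_bounds)
  ultimately show ?thesis using inv unfolding g_def by linarith
qed

lemma record_avg_finite_set:
  "finite A \<Longrightarrow> record_avg n (indicat_real A) = (\<Sum>k\<in>A. record_avg n (indicat_real {k}))"
proof (induction A rule: finite_induct)
  case empty
  show ?case using record_avg_linear[of n 0 "\<lambda>_. 0" 0 "\<lambda>_. 0"] by simp
next
  case (insert k A)
  hence "indicat_real (insert k A) = (\<lambda>l. 1 * indicat_real {k} l - (-1) * indicat_real A l)"
    by (auto simp: indicator_def)
  hence "record_avg n (indicat_real (insert k A)) =
      1 * record_avg n (indicat_real {k}) - (-1) * record_avg n (indicat_real A)"
    by (simp only: record_avg_linear)
  thus ?case using insert by simp
qed

lemma record_avg_limit:
  assumes "finite A"
  shows "(\<lambda>n. record_avg n (indicat_real A) / harm n) \<longlonglongrightarrow> (\<Sum>k\<in>A. 1 / 2 ^ (k + 1))"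
proof -
  have "(\<lambda>n. record_avg n (indicat_real {k}) / harm n) \<longlonglongrightarrow> 1 / 2 ^ (k + 1)" for k
  proof (rule LIM_zero_cancel, rule Lim_null_comparison)
    show "\<forall>\<^sub>F n in sequentially. norm (record_avg n (indicat_real {k}) / harm n - 1 / 2 ^ (k + 1)) \<le> 1 / harm n"
      using eventually_gt_at_top[of 0]
    proof eventually_elim
      case (elim n)
      hence pos: "harm n > (0 :: real)" by (rule harm_pos)
      hence nz: "harm n \<noteq> (0 :: real)" by linarith
      have "(record_avg n (indicat_real {k}) / harm n - 1 / 2 ^ (k + 1)) =
          (record_avg n (indicat_real {k}) - harm n / 2 ^ (k + 1)) / harm n"
        using pos by (simp add: diff_divide_distrib nz del: harm_pos_iff)
      also have "norm \<dots> = \<bar>record_avg n (indicat_real {k}) - harm n / 2 ^ (k + 1)\<bar> / harm n"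
        using pos by (simp add: abs_divide)
      also have "\<dots> \<le> 1 / harm n"
        by (rule divide_right_mono[OF record_avg_point harm_nonneg])
      finally show ?case .
    qed
    show "(\<lambda>n. 1 / harm n :: real) \<longlonglongrightarrow> 0"
      by (intro tendsto_divide_0[OF tendsto_const] filterlim_at_top_imp_at_infinity harm_at_top)
  qed
  thus ?thesis
    unfolding record_avg_finite_set[OF assms] sum_divide_distrib by (intro tendsto_sum)
qed

lemma record_avg_quotient_limit:
  fixes f :: "nat \<Rightarrow> real"
  assumes "\<And>n. n \<ge> 1 \<Longrightarrow> f n = record_avg n (indicat_real A) / harm n" "finite A"
  shows "f \<longlonglongrightarrow> (\<Sum>k\<in>A. 1 / 2 ^ (k + 1))"
  using record_avg_limit[OF assms(2)]
  by (rule Lim_transform_eventually) (use assms(1) in \<open>auto intro!: eventually_sequentiallyI[of 1]\<close>)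

section \<open>From labelled observations to configurations\<close>

text \<open>
  The event that observation \<open>m\<close>, regarded as the last one among those with labels in \<open>S\<close>, sets a
  record and breaks a number of records that lies in \<open>A\<close>. Not tying \<open>m\<close> to the largest label
  is what allows the average over \<open>m\<close>.
\<close>
definition record_event :: "nat set \<Rightarrow> 'i set \<Rightarrow> ('i \<Rightarrow> real \<times> real) \<Rightarrow> 'i \<Rightarrow> bool"
  where "record_event A S x m \<longleftrightarrow> (\<forall>i\<in>S. \<not> x i \<prec> x m) \<and>
    card {j\<in>S. x m \<prec> x j \<and> (\<forall>i\<in>S - {m}. \<not> x i \<prec> x j)} \<in> A"

lemma record_event_cong:
  assumes "\<And>i. i \<in> S \<Longrightarrow> x i = y i" "m \<in> S"
  shows "record_event A S x m \<longleftrightarrow> record_event A S y m"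
proof -
  have "{j\<in>S. x m \<prec> x j \<and> (\<forall>i\<in>S - {m}. \<not> x i \<prec> x j)} =
      {j\<in>S. y m \<prec> y j \<and> (\<forall>i\<in>S - {m}. \<not> y i \<prec> y j)}"
    using assms by auto
  moreover have "(\<forall>i\<in>S. \<not> x i \<prec> x m) \<longleftrightarrow> (\<forall>i\<in>S. \<not> y i \<prec> y m)"
    using assms by auto
  ultimately show ?thesis
    unfolding record_event_def by (simp only:)
qed

lemma record_event_permute:
  assumes "\<tau> permutes S" "m \<in> S"
  shows "record_event A S (\<lambda>i. x (\<tau> i)) m \<longleftrightarrow> record_event A S x (\<tau> m)"
proof -
  have all: "(\<forall>i\<in>T. P (\<tau> i)) \<longleftrightarrow> (\<forall>i\<in>\<tau> ` T. P i)" for P T by auto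
  have img: "\<tau> ` {j\<in>S. Q (\<tau> j)} = {j\<in>\<tau> ` S. Q j}" for Q by auto
  have im: "\<tau> ` S = S" using assms(1) by (rule permutes_image)
  have inj: "inj \<tau>" using assms(1) by (rule permutes_inj)
  have im': "\<tau> ` (S - {m}) = S - {\<tau> m}"
    using im inj by (simp add: image_set_diff)
  let ?Q = "\<lambda>j. x (\<tau> m) \<prec> x j \<and> (\<forall>i\<in>S - {\<tau> m}. \<not> x i \<prec> x j)"
  have "{j\<in>S. x (\<tau> m) \<prec> x (\<tau> j) \<and> (\<forall>i\<in>S - {m}. \<not> x (\<tau> i) \<prec> x (\<tau> j))} = {j\<in>S. ?Q (\<tau> j)}"
    using all[of "S - {m}"] unfolding im' by (intro Collect_cong conj_cong refl)
  moreover have "\<tau> ` {j\<in>S. ?Q (\<tau> j)} = {j\<in>S. ?Q j}"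
    using img[of ?Q] unfolding im .
  ultimately have "card {j\<in>S. x (\<tau> m) \<prec> x (\<tau> j) \<and> (\<forall>i\<in>S - {m}. \<not> x (\<tau> i) \<prec> x (\<tau> j))} =
      card {j\<in>S. ?Q j}"
    using card_image[OF inj_on_subset[OF inj subset_UNIV], of "{j\<in>S. ?Q (\<tau> j)}"] by (simp only:)
  moreover have "(\<forall>i\<in>S. \<not> x (\<tau> i) \<prec> x (\<tau> m)) \<longleftrightarrow> (\<forall>i\<in>S. \<not> x i \<prec> x (\<tau> m))"
    using all[of S] unfolding im .
  ultimately show ?thesis
    unfolding record_event_def by (simp only:)
qed

text \<open>
  Summed over the observation that plays the part of the last one, the events depend on the set of
  points only, not on its labelling.
\<close>
lemma sum_record_event:
  assumes "finite S" "inj_on x S"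
  shows "(\<Sum>m\<in>S. of_bool (record_event A S x m)) = record_sum (indicat_real A) (x ` S)"
proof -
  have und: "undominated (x ` T) p \<longleftrightarrow> (\<forall>i\<in>T. \<not> x i \<prec> p)" for T p
    by (auto simp: undominated_def)
  have kills: "kills (x ` S) (x m) = card {j\<in>S. x m \<prec> x j \<and> (\<forall>i\<in>S - {m}. \<not> x i \<prec> x j)}"
    if m: "m \<in> S" for m
  proof -
    have "x ` S - {x m} = x ` (S - {m})"
      using assms(2) m by (auto simp: inj_on_def)
    hence "{q \<in> x ` S. x m \<prec> q \<and> undominated (x ` S - {x m}) q} =
        x ` {j\<in>S. x m \<prec> x j \<and> (\<forall>i\<in>S - {m}. \<not> x i \<prec> x j)}"
      by (auto simp: und)
    thus ?thesis
      unfolding kills_def using assms(2) by (simp add: card_image inj_on_subset)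
  qed
  have eq: "{p. p \<in> x ` S \<and> undominated (x ` S) p} = x ` {m\<in>S. \<forall>i\<in>S. \<not> x i \<prec> x m}"
    by (auto simp: und)
  have "record_sum (indicat_real A) (x ` S) =
      (\<Sum>m\<in>{m\<in>S. \<forall>i\<in>S. \<not> x i \<prec> x m}. indicat_real A (kills (x ` S) (x m)))"
    unfolding record_sum_def eq
    by (subst sum.reindex) (auto intro: inj_on_subset[OF assms(2)])
  also have "\<dots> = (\<Sum>m\<in>S. if \<forall>i\<in>S. \<not> x i \<prec> x m then indicat_real A (kills (x ` S) (x m)) else 0)"
    using assms(1) by (rule sum.inter_filter)
  also have "\<dots> = (\<Sum>m\<in>S. of_bool (record_event A S x m))"
  proof (rule sum.cong[OF refl])
    fix m assume "m \<in> S"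
    thus "(if \<forall>i\<in>S. \<not> x i \<prec> x m then indicat_real A (kills (x ` S) (x m)) else 0) =
        of_bool (record_event A S x m)"
      unfolding kills[OF \<open>m \<in> S\<close>] record_event_def by (simp only: indicator_def of_bool_def split: if_split) simp
  qed
  finally show ?thesis by simp
qed

lemma obtain_decreasing_enumeration:
  fixes u :: "'i :: linorder \<Rightarrow> real"
  assumes "finite S" "inj_on u S"
  obtains js where "set js = S" "distinct js" "sorted_wrt (>) (map u js)"
proof
  let ?l = "sort_key u (sorted_list_of_set S)"
  show "set (rev ?l) = S" "distinct (rev ?l)"
    using assms(1) by simp_all
  have "sorted_wrt (<) (map u ?l)"
    using assms by (simp add: strict_sorted_iff distinct_map)
  thus "sorted_wrt (>) (map u (rev ?l))"
    by (simp add: rev_map[symmetric] sorted_wrt_rev)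
qed

text \<open>
  Listing the labels by decreasing abscissa identifies the permutations of the ordinates with the
  enumerations of the set of ordinates.
\<close>
lemma sum_shuffled_configurations:
  fixes u v :: "'i :: linorder \<Rightarrow> real"
  assumes fin: "finite S" and u: "inj_on u S" and v: "inj_on v S"
  shows "(\<Sum>\<rho> | \<rho> permutes S. record_sum g ((\<lambda>i. (u i, v (\<rho> i))) ` S)) =
    fact (card S) * record_avg (card S) g"
proof -
  obtain js where js: "set js = S" "distinct js" "sorted_wrt (>) (map u js)"
    using obtain_decreasing_enumeration[OF fin u] by blast
  have len: "length js = card S" using js distinct_card by fastforce
  let ?f = "\<lambda>\<rho>. map (\<lambda>i. v (\<rho> i)) js"
  have inj: "inj_on ?f {\<rho>. \<rho> permutes S}"
  proof (rule inj_onI, rule ext)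
    fix \<rho> \<rho>' i assume *: "\<rho> \<in> {\<rho>. \<rho> permutes S}" "\<rho>' \<in> {\<rho>. \<rho> permutes S}" "?f \<rho> = ?f \<rho>'"
    show "\<rho> i = \<rho>' i"
    proof (cases "i \<in> S")
      case True
      hence "v (\<rho> i) = v (\<rho>' i)" using *(3) js(1) by simp
      thus ?thesis using True * v by (simp add: inj_on_def permutes_in_image)
    next
      case False
      thus ?thesis using * by (simp add: permutes_not_in)
    qed
  qed
  have sub: "?f ` {\<rho>. \<rho> permutes S} \<subseteq> permutations_of_set (v ` S)"
  proof clarify
    fix \<rho> assume \<rho>: "\<rho> permutes S"
    have "set (?f \<rho>) = v ` S"
      using js(1) permutes_image[OF \<rho>] by (metis image_image list.set_map)
    moreover have "distinct (?f \<rho>)"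
      using js v permutes_inj[OF \<rho>] permutes_in_image[OF \<rho>]
      by (auto simp: distinct_map inj_on_def)
    ultimately show "?f \<rho> \<in> permutations_of_set (v ` S)"
      by (simp add: permutations_of_set_def)
  qed
  have "card (?f ` {\<rho>. \<rho> permutes S}) = card (permutations_of_set (v ` S))"
    using fin v inj by (simp add: card_image card_permutations[OF refl])
  hence im: "?f ` {\<rho>. \<rho> permutes S} = permutations_of_set (v ` S)"
    using sub by (intro card_subset_eq) auto
  have "(\<Sum>ys\<in>permutations_of_set (v ` S). record_sum g (set (zip (map u js) ys))) =
      (\<Sum>\<rho> | \<rho> permutes S. record_sum g (set (zip (map u js) (?f \<rho>))))"
    unfolding im[symmetric] by (subst sum.reindex[OF inj]) simp
  also have "\<dots> = (\<Sum>\<rho> | \<rho> permutes S. record_sum g ((\<lambda>i. (u i, v (\<rho> i))) ` S))"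
    by (simp add: zip_map_map zip_same_conv_map js(1) image_image)
  finally show ?thesis
    using sums_over_configurations[OF js(3), of "v ` S" g] fin v len by (simp add: card_image)
qed

lemma sum_record_event_shuffled:
  fixes u v :: "'i :: linorder \<Rightarrow> real"
  assumes fin: "finite S" and u: "inj_on u S" and v: "inj_on v S"
  shows "(\<Sum>m\<in>S. \<Sum>\<rho> | \<rho> permutes S. of_bool (record_event A S (\<lambda>i. (u i, v (\<rho> i))) m)) =
    fact (card S) * record_avg (card S) (indicat_real A)"
proof -
  have "inj_on (\<lambda>i. (u i, v (\<rho> i))) S" for \<rho>
    using u by (auto simp: inj_on_def)
  thus ?thesis
    by (subst sum.swap)
      (simp add: sum_record_event[OF fin] sum_shuffled_configurations[OF assms])
qed

section \<open>Independent atomless coordinates\<close>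

definition unif :: "real measure"
  where "unif = uniform_measure lborel {0<..<1}"

lemma prob_space_unif: "prob_space unif"
  unfolding unif_def by (rule prob_space_uniform_measure) auto

lemma sets_unif [measurable_cong, simp]: "sets unif = sets borel"
  by (simp add: unif_def)

lemma space_unif [simp]: "space unif = UNIV"
  by (simp add: unif_def)

lemma emeasure_unif_singleton: "emeasure unif {x} = 0"
proof -
  have "emeasure lborel ({0<..<1} \<inter> {x}) \<le> emeasure lborel {x}"
    by (rule emeasure_mono) auto
  thus ?thesis by (simp add: unif_def)
qed

lemma uniform_square_eq_pair:
  "uniform_measure lborel ({0<..<1} \<times> {0<..<1}) = unif \<Otimes>\<^sub>M unif"
proof (rule pair_measure_eqI[symmetric])
  show "sigma_finite_measure unif"
    using prob_space_unif prob_space_imp_sigma_finite by blast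
  thus "sigma_finite_measure unif" .
  show "sets (unif \<Otimes>\<^sub>M unif) = sets (uniform_measure lborel ({0<..<1} \<times> {0<..<1}))"
  proof -
    have "sets (unif \<Otimes>\<^sub>M unif) = sets (borel :: (real \<times> real) measure)"
      unfolding borel_prod[symmetric] by (intro sets_pair_measure_cong) simp_all
    thus ?thesis by simp
  qed
next
  fix A B :: "real set" assume "A \<in> sets unif" "B \<in> sets unif"
  hence [measurable]: "A \<in> sets borel" "B \<in> sets borel" by simp_all
  have times: "emeasure lborel (C \<times> D) = emeasure lborel C * emeasure lborel D"
    if "C \<in> sets borel" "D \<in> sets borel" for C D :: "real set"
    using that by (simp add: lborel_prod[symmetric] lborel.emeasure_pair_measure_Times)
  have "({0<..<1} \<times> {0<..<1}) \<inter> (A \<times> B) = ({0<..<1} \<inter> A) \<times> ({0<..<1} \<inter> B)" by auto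
  moreover have "A \<times> B \<in> sets (borel :: (real \<times> real) measure)"
    "{0<..<1} \<times> {0<..<1} \<in> sets (borel :: (real \<times> real) measure)"
    by (auto simp: borel_prod[symmetric])
  ultimately show "emeasure unif A * emeasure unif B =
      emeasure (uniform_measure lborel ({0<..<1} \<times> {0<..<1})) (A \<times> B)"
    by (simp add: unif_def times divide_ennreal_def)
qed

lemma nn_integral_prod_permuted:
  assumes "sigma_finite_measure U" "finite S" "\<sigma> permutes S"
    and f: "\<And>i. i \<in> S \<Longrightarrow> f i \<in> borel_measurable U"
  shows "(\<integral>\<^sup>+x. (\<Prod>i\<in>S. f i (x (\<sigma> i))) \<partial>PiM S (\<lambda>_. U)) = (\<Prod>i\<in>S. \<integral>\<^sup>+y. f i y \<partial>U)"
proof -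
  interpret product_sigma_finite "\<lambda>_. U" using assms(1) by (simp add: product_sigma_finite_def)
  let ?\<sigma>' = "inv_into UNIV \<sigma>"
  have inv: "?\<sigma>' permutes S" using assms(3) by (rule permutes_inv)
  have "(\<Prod>i\<in>S. f i (x (\<sigma> i))) = (\<Prod>i\<in>S. f (?\<sigma>' i) (x i))" for x
    using prod.permute[OF assms(3), of "\<lambda>i. f (?\<sigma>' i) (x i)"] permutes_inverses(2)[OF assms(3)]
    by (simp add: o_def)
  hence "(\<integral>\<^sup>+x. (\<Prod>i\<in>S. f i (x (\<sigma> i))) \<partial>PiM S (\<lambda>_. U)) = (\<Prod>i\<in>S. \<integral>\<^sup>+y. f (?\<sigma>' i) y \<partial>U)"
    using product_nn_integral_prod[OF assms(2), of "\<lambda>i. f (?\<sigma>' i)"] f permutes_in_image[OF inv] by simp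
  also have "\<dots> = (\<Prod>i\<in>S. \<integral>\<^sup>+y. f i y \<partial>U)"
    using prod.permute[OF inv, of "\<lambda>i. \<integral>\<^sup>+y. f i y \<partial>U"] by (simp add: o_def)
  finally show ?thesis .
qed

text \<open>
  Independent points with independent coordinates can be assembled from a sequence of abscissae
  and a sequence of ordinates after shuffling each of them. On boxes this is Fubini's theorem:
  given the abscissae, the integral over the ordinates factorises, and the factors depend on one
  abscissa each.
\<close>
lemma distr_shuffled_coordinates:
  assumes U: "prob_space U" and V: "prob_space V" and fin: "finite S"
    and \<tau>: "\<tau> permutes S" and \<rho>: "\<rho> permutes S"
  shows "distr (PiM S (\<lambda>_. U) \<Otimes>\<^sub>M PiM S (\<lambda>_. V)) (PiM S (\<lambda>_. U \<Otimes>\<^sub>M V))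
      (\<lambda>w. \<lambda>i\<in>S. (fst w (\<tau> i), snd w (\<rho> i))) = PiM S (\<lambda>_. U \<Otimes>\<^sub>M V)"
    (is "distr ?N ?P ?G = _")
proof -
  interpret U: prob_space U by fact
  interpret V: prob_space V by fact
  interpret UV: pair_prob_space U V ..
  interpret PV: prob_space "PiM S (\<lambda>_. V)" using V by (intro prob_space_PiM)
  interpret prod: product_sigma_finite "\<lambda>_. U \<Otimes>\<^sub>M V"
    by (simp add: product_sigma_finite_def UV.sigma_finite_measure_axioms)
  have G [measurable]: "?G \<in> ?N \<rightarrow>\<^sub>M ?P"
    using permutes_in_image[OF \<tau>] permutes_in_image[OF \<rho>]
    by (intro measurable_restrict measurable_Pair measurable_compose[OF measurable_fst]
        measurable_compose[OF measurable_snd] measurable_component_singleton) auto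
  show ?thesis
  proof (rule prod.PiM_eqI[OF fin])
    fix E assume E [measurable]: "\<And>i. i \<in> S \<Longrightarrow> E i \<in> sets (U \<Otimes>\<^sub>M V)"
    have box: "Pi\<^sub>E S E \<in> sets ?P" using E fin by (intro sets_PiM_I_finite) auto
    have ind: "indicator (Pi\<^sub>E S E) (?G (u, v)) =
        (\<Prod>i\<in>S. indicator (E i) (u (\<tau> i), v (\<rho> i)) :: ennreal)" for u v
      using fin by (auto simp: indicator_def PiE_def Pi_def prod_zero_iff)
    have "emeasure (distr ?N ?P ?G) (Pi\<^sub>E S E) = (\<integral>\<^sup>+x. indicator (Pi\<^sub>E S E) x \<partial>distr ?N ?P ?G)"
      using box by (intro nn_integral_indicator[symmetric]) (simp only: sets_distr)
    also have "\<dots> = (\<integral>\<^sup>+w. indicator (Pi\<^sub>E S E) (?G w) \<partial>?N)"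
      using borel_measurable_indicator[OF box] by (intro nn_integral_distr[OF G]) simp
    also have "\<dots> = (\<integral>\<^sup>+u. \<integral>\<^sup>+v. indicator (Pi\<^sub>E S E) (?G (u, v)) \<partial>PiM S (\<lambda>_. V) \<partial>PiM S (\<lambda>_. U))"
      using PV.nn_integral_fst[OF measurable_compose[OF G borel_measurable_indicator[OF box]]] by simp
    also have "\<dots> = (\<integral>\<^sup>+u. (\<Prod>i\<in>S. \<integral>\<^sup>+v. indicator (E i) (u (\<tau> i), v) \<partial>V) \<partial>PiM S (\<lambda>_. U))"
    proof (rule nn_integral_cong)
      fix u assume "u \<in> space (PiM S (\<lambda>_. U))"
      hence "u (\<tau> i) \<in> space U" if "i \<in> S" for i
        using that permutes_in_image[OF \<tau>] by (auto simp: space_PiM PiE_def Pi_def)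
      hence "(\<lambda>v. indicator (E i) (u (\<tau> i), v) :: ennreal) \<in> borel_measurable V" if "i \<in> S" for i
        using that E[OF that] by measurable
      thus "(\<integral>\<^sup>+v. indicator (Pi\<^sub>E S E) (?G (u, v)) \<partial>PiM S (\<lambda>_. V)) =
          (\<Prod>i\<in>S. \<integral>\<^sup>+v. indicator (E i) (u (\<tau> i), v) \<partial>V)"
        unfolding ind by (intro nn_integral_prod_permuted V.sigma_finite_measure_axioms fin \<rho>)
    qed
    also have "\<dots> = (\<Prod>i\<in>S. \<integral>\<^sup>+u. \<integral>\<^sup>+v. indicator (E i) (u, v) \<partial>V \<partial>U)"
      using E by (intro nn_integral_prod_permuted U.sigma_finite_measure_axioms fin \<tau>) measurable
    also have "\<dots> = (\<Prod>i\<in>S. emeasure (U \<Otimes>\<^sub>M V) (E i))"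
      using E by (intro prod.cong refl) (simp add: V.nn_integral_fst)
    finally show "emeasure (distr ?N ?P ?G) (Pi\<^sub>E S E) = (\<Prod>i\<in>S. emeasure (U \<Otimes>\<^sub>M V) (E i))" .
  qed simp
qed

text \<open>
  For fixed \<open>i \<noteq> j\<close>, integrate over coordinate \<open>j\<close> first: given the other coordinates, the event
  of a tie has the measure of a single point.
\<close>
lemma AE_PiM_inj_on:
  fixes S :: "'i set" and U :: "real measure"
  assumes U: "prob_space U" and [measurable_cong, simp]: "sets U = sets borel"
    and atomless: "\<And>x. emeasure U {x} = 0" and fin: "finite S"
  shows "AE u in PiM S (\<lambda>_. U). inj_on u S"
proof -
  interpret U: prob_space U by fact
  interpret product_sigma_finite "\<lambda>_. U"
    by (simp add: product_sigma_finite_def U.sigma_finite_measure_axioms)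
  have ne: "AE u in PiM S (\<lambda>_. U). u i \<noteq> u j" if ij: "i \<in> S" "j \<in> S" "i \<noteq> j" for i j
  proof -
    have S: "S = insert j (S - {j})" using ij by auto
    have [measurable]: "(\<lambda>u. u i) \<in> PiM S (\<lambda>_. U) \<rightarrow>\<^sub>M borel" "(\<lambda>u. u j) \<in> PiM S (\<lambda>_. U) \<rightarrow>\<^sub>M borel"
      using measurable_component_singleton[of i S "\<lambda>_. U"] measurable_component_singleton[of j S "\<lambda>_. U"] ij
      by (simp_all cong: measurable_cong_sets)
    let ?f = "\<lambda>u. indicator {u \<in> space (PiM S (\<lambda>_. U)). u i = u j} u :: ennreal"
    let ?h = "\<lambda>u. indicator {0} (u i - u j) :: ennreal"
    have h: "?h \<in> borel_measurable (PiM (insert j (S - {j})) (\<lambda>_. U))"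
      unfolding S[symmetric] by measurable
    have "emeasure (PiM S (\<lambda>_. U)) {u \<in> space (PiM S (\<lambda>_. U)). u i = u j} = (\<integral>\<^sup>+u. ?f u \<partial>PiM S (\<lambda>_. U))"
      by (rule nn_integral_indicator[symmetric]) measurable
    also have "\<dots> = (\<integral>\<^sup>+u. ?h u \<partial>PiM S (\<lambda>_. U))"
      by (intro nn_integral_cong) (simp add: indicator_def)
    also have "\<dots> = (\<integral>\<^sup>+u. \<integral>\<^sup>+y. ?h (u(j := y)) \<partial>U \<partial>PiM (S - {j}) (\<lambda>_. U))"
      using product_nn_integral_insert[OF _ _ h] fin unfolding S[symmetric] by simp
    also have "\<dots> = (\<integral>\<^sup>+u. \<integral>\<^sup>+y. indicator {u i} y \<partial>U \<partial>PiM (S - {j}) (\<lambda>_. U))"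
      using ij by (intro nn_integral_cong) (simp add: indicator_def)
    also have "\<dots> = 0" by (simp add: atomless)
    finally show ?thesis
      by (intro AE_I[of _ _ "{u \<in> space (PiM S (\<lambda>_. U)). u i = u j}"]) auto
  qed
  have "AE u in PiM S (\<lambda>_. U). \<forall>i\<in>S. \<forall>j\<in>S. i \<noteq> j \<longrightarrow> u i \<noteq> u j"
    using fin ne by (intro AE_finite_allI) (auto intro: AE_impI)
  thus ?thesis by eventually_elim (auto simp: inj_on_def)
qed

text \<open>
  The cardinality is determined by which of finitely many conditions hold, so the event is a
  finite union over the possible index sets \<open>T\<close>.
\<close>
lemma pred_card_Collect:
  assumes fin: "finite S" and Q: "\<And>j. j \<in> S \<Longrightarrow> Measurable.pred M (\<lambda>w. Q w j)"
  shows "Measurable.pred M (\<lambda>w. card {j\<in>S. Q w j} \<in> A)"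
proof -
  have eq: "card {j\<in>S. Q w j} \<in> A \<longleftrightarrow> (\<exists>T\<in>{T. T \<subseteq> S \<and> card T \<in> A}. \<forall>j\<in>S. Q w j \<longleftrightarrow> j \<in> T)" for w
  proof
    assume "card {j\<in>S. Q w j} \<in> A"
    thus "\<exists>T\<in>{T. T \<subseteq> S \<and> card T \<in> A}. \<forall>j\<in>S. Q w j \<longleftrightarrow> j \<in> T"
      by (intro bexI[of _ "{j\<in>S. Q w j}"]) simp_all
  next
    assume "\<exists>T\<in>{T. T \<subseteq> S \<and> card T \<in> A}. \<forall>j\<in>S. Q w j \<longleftrightarrow> j \<in> T"
    then obtain T where T: "T \<subseteq> S" "card T \<in> A" "\<forall>j\<in>S. Q w j \<longleftrightarrow> j \<in> T" by blast
    hence "{j\<in>S. Q w j} = T" by blast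
    thus "card {j\<in>S. Q w j} \<in> A" using T(2) by simp
  qed
  have "finite {T. T \<subseteq> S \<and> card T \<in> A}"
    using fin by simp
  thus ?thesis
    unfolding eq using fin Q by (intro pred_intros_finite pred_intros_logic) auto
qed

lemma pred_record_event:
  fixes S :: "'i set"
  assumes x [measurable]: "\<And>i. i \<in> S \<Longrightarrow> (\<lambda>w. x w i) \<in> M \<rightarrow>\<^sub>M borel"
    and fin: "finite S" and m: "m \<in> S"
  shows "Measurable.pred M (\<lambda>w. record_event A S (x w) m)"
proof -
  have prec [measurable]: "Measurable.pred M (\<lambda>w. x w i \<prec> x w j)" if "i \<in> S" "j \<in> S" for i j
  proof -
    have "fst \<in> borel_measurable (borel :: (real \<times> real) measure)"
      "snd \<in> borel_measurable (borel :: (real \<times> real) measure)"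
      by (auto intro!: borel_measurable_continuous_onI continuous_intros)
    hence [measurable]: "(\<lambda>w. fst (x w k)) \<in> borel_measurable M" "(\<lambda>w. snd (x w k)) \<in> borel_measurable M"
      if "k \<in> {i, j}" for k
      using that \<open>i \<in> S\<close> \<open>j \<in> S\<close> x by (auto intro: measurable_compose)
    show ?thesis
      unfolding precedes_def by (intro pred_intros_logic borel_measurable_pred_less) auto
  qed
  let ?Q = "\<lambda>w j. x w m \<prec> x w j \<and> (\<forall>i\<in>S - {m}. \<not> x w i \<prec> x w j)"
  have Q: "Measurable.pred M (\<lambda>w. ?Q w j)" if "j \<in> S" for j
    using that m fin by (intro pred_intros_logic pred_intros_finite prec) auto
  have "Measurable.pred M (\<lambda>w. card {j\<in>S. ?Q w j} \<in> A)"
    using fin Q by (rule pred_card_Collect)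
  moreover have "Measurable.pred M (\<lambda>w. \<forall>i\<in>S. \<not> x w i \<prec> x w m)"
    using fin m by (intro pred_intros_logic pred_intros_finite prec) auto
  ultimately show ?thesis
    unfolding record_event_def by (intro pred_intros_logic)
qed

text \<open>
  By \<open>distr_shuffled_coordinates\<close> the event has the same probability \<open>p\<close> for every choice of the last
  observation \<open>m\<close> and every permutation \<open>\<rho>\<close> of the ordinates. The sum of the corresponding
  indicators is almost surely constant by \<open>sum_record_event_shuffled\<close>, so integrating it determines
  \<open>card S * fact (card S) * p\<close>.
\<close>
lemma measure_record_event:
  fixes S :: "'i :: linorder set" and U V :: "real measure"
  assumes U: "prob_space U" "sets U = sets borel" "\<And>x. emeasure U {x} = 0"
    and V: "prob_space V" "sets V = sets borel" "\<And>x. emeasure V {x} = 0"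
    and fin: "finite S" and n: "n \<in> S"
  shows "measure (PiM S (\<lambda>_. U \<Otimes>\<^sub>M V)) {x \<in> space (PiM S (\<lambda>_. U \<Otimes>\<^sub>M V)). record_event A S x n} =
    record_avg (card S) (indicat_real A) / card S"
proof -
  let ?P = "PiM S (\<lambda>_. U \<Otimes>\<^sub>M V)" and ?PU = "PiM S (\<lambda>_. U)" and ?PV = "PiM S (\<lambda>_. V)"
  let ?N = "?PU \<Otimes>\<^sub>M ?PV"
  note [measurable_cong, simp] = U(2) V(2)
  interpret PU: prob_space ?PU using U(1) by (intro prob_space_PiM)
  interpret PV: prob_space ?PV using V(1) by (intro prob_space_PiM)
  interpret N: pair_prob_space ?PU ?PV ..
  define p where "p = measure ?P {x \<in> space ?P. record_event A S x n}"
  have fst_N: "(\<lambda>w. fst w i) \<in> ?N \<rightarrow>\<^sub>M borel" and snd_N: "(\<lambda>w. snd w i) \<in> ?N \<rightarrow>\<^sub>M borel"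
    if "i \<in> S" for i
  proof -
    have "(\<lambda>w. fst w i) \<in> ?N \<rightarrow>\<^sub>M U" "(\<lambda>w. snd w i) \<in> ?N \<rightarrow>\<^sub>M V"
      using that by (auto intro!: measurable_compose[OF measurable_fst] measurable_compose[OF measurable_snd])
    thus "(\<lambda>w. fst w i) \<in> ?N \<rightarrow>\<^sub>M borel" "(\<lambda>w. snd w i) \<in> ?N \<rightarrow>\<^sub>M borel"
      by (simp_all cong: measurable_cong_sets)
  qed
  have pred_N: "Measurable.pred ?N (\<lambda>w. record_event A S (\<lambda>i. (fst w i, snd w (\<rho> i))) m)"
    if "\<rho> permutes S" "m \<in> S" for \<rho> m
    using that fin permutes_in_image[OF that(1)]
    by (intro pred_record_event) (auto intro!: borel_measurable_Pair fst_N snd_N)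
  have pred_P: "Measurable.pred ?P (\<lambda>x. record_event A S x n)"
  proof (rule pred_record_event[OF _ fin n])
    fix i assume "i \<in> S"
    hence "(\<lambda>x. x i) \<in> ?P \<rightarrow>\<^sub>M U \<Otimes>\<^sub>M V" by (rule measurable_component_singleton)
    moreover have "sets (U \<Otimes>\<^sub>M V) = sets (borel :: (real \<times> real) measure)"
      unfolding borel_prod[symmetric] by (intro sets_pair_measure_cong) simp_all
    ultimately show "(\<lambda>x. x i) \<in> ?P \<rightarrow>\<^sub>M borel"
      using measurable_cong_sets[OF refl, of "U \<Otimes>\<^sub>M V" borel ?P] by blast
  qed
  have shuffle: "p = (\<integral>w. of_bool (record_event A S (\<lambda>i. (fst w i, snd w (\<rho> i))) m) \<partial>?N)"
    if m: "m \<in> S" and \<rho>: "\<rho> permutes S" for m \<rho>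
  proof -
    \<comment> \<open>Swapping \<open>n\<close> and \<open>m\<close> moves the part of the last observation to \<open>m\<close>; composing \<open>\<rho>\<close> with the
      swap makes the abscissae and the ordinates move together up to \<open>\<rho>\<close>.\<close>
    define \<tau> where "\<tau> = Transposition.transpose n m"
    have \<tau>: "\<tau> permutes S" using n m by (simp add: \<tau>_def permutes_swap_id)
    let ?G = "\<lambda>w. \<lambda>i\<in>S. (fst w (\<tau> i), snd w ((\<rho> \<circ> \<tau>) i))"
    have \<rho>\<tau>: "\<rho> \<circ> \<tau> permutes S" using \<tau> \<rho> by (rule permutes_compose)
    have ev: "record_event A S (?G w) n \<longleftrightarrow> record_event A S (\<lambda>i. (fst w i, snd w (\<rho> i))) m" for w
    proof -
      have "record_event A S (?G w) n \<longleftrightarrow> record_event A S (\<lambda>i. (\<lambda>i. (fst w i, snd w (\<rho> i))) (\<tau> i)) n"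
        using n by (intro record_event_cong) auto
      also have "\<dots> \<longleftrightarrow> record_event A S (\<lambda>i. (fst w i, snd w (\<rho> i))) (\<tau> n)"
        using \<tau> n by (rule record_event_permute)
      finally show ?thesis by (simp add: \<tau>_def)
    qed
    have G: "?G \<in> ?N \<rightarrow>\<^sub>M ?P"
      using permutes_in_image[OF \<tau>] permutes_in_image[OF \<rho>\<tau>]
      by (intro measurable_restrict measurable_Pair measurable_compose[OF measurable_fst]
        measurable_compose[OF measurable_snd] measurable_component_singleton) auto
    have "p = measure (distr ?N ?P ?G) {x \<in> space ?P. record_event A S x n}"
      unfolding p_def distr_shuffled_coordinates[OF U(1) V(1) fin \<tau> \<rho>\<tau>] ..
    also have "\<dots> = measure ?N (?G -` {x \<in> space ?P. record_event A S x n} \<inter> space ?N)"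
      using pred_P by (intro measure_distr[OF G]) (simp add: pred_def)
    also have "?G -` {x \<in> space ?P. record_event A S x n} \<inter> space ?N =
        {w \<in> space ?N. record_event A S (\<lambda>i. (fst w i, snd w (\<rho> i))) m}"
      using measurable_space[OF G] ev by auto
    also have "measure ?N \<dots> = (\<integral>w. indicat_real {w \<in> space ?N. record_event A S (\<lambda>i. (fst w i, snd w (\<rho> i))) m} w \<partial>?N)"
      by (auto intro!: arg_cong[where f = "measure ?N"])
    also have "\<dots> = (\<integral>w. of_bool (record_event A S (\<lambda>i. (fst w i, snd w (\<rho> i))) m) \<partial>?N)"
      by (intro Bochner_Integration.integral_cong) (auto simp: indicator_def)
    finally show ?thesis .
  qed
  have AE: "AE w in ?N. inj_on (fst w) S \<and> inj_on (snd w) S"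
  proof (rule N.AE_pair_measure)
    show "{w \<in> space ?N. inj_on (fst w) S \<and> inj_on (snd w) S} \<in> sets ?N"
      unfolding inj_on_def pred_def[symmetric]
      using fin fst_N snd_N by (intro pred_intros_logic pred_intros_finite) measurable
    have "AE v in ?PV. inj_on v S" "AE u in ?PU. inj_on u S"
      using U V fin by (auto intro: AE_PiM_inj_on)
    thus "AE u in ?PU. AE v in ?PV. inj_on (fst (u, v)) S \<and> inj_on (snd (u, v)) S"
      by auto
  qed
  have int: "integrable ?N (\<lambda>w. of_bool (record_event A S (\<lambda>i. (fst w i, snd w (\<rho> i))) m) :: real)"
    if "m \<in> S" "\<rho> permutes S" for m \<rho>
    using pred_N[OF that(2,1)] by (intro N.integrable_const_bound[of _ 1]) (simp_all add: of_bool_def)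
  have "card S * fact (card S) * p = (\<Sum>m\<in>S. \<Sum>\<rho> | \<rho> permutes S. p)"
    using fin by (simp add: card_permutations)
  also have "\<dots> = (\<Sum>m\<in>S. \<Sum>\<rho> | \<rho> permutes S.
      \<integral>w. of_bool (record_event A S (\<lambda>i. (fst w i, snd w (\<rho> i))) m) \<partial>?N)"
    using shuffle by (intro sum.cong refl) simp
  also have "\<dots> = (\<integral>w. (\<Sum>m\<in>S. \<Sum>\<rho> | \<rho> permutes S.
      of_bool (record_event A S (\<lambda>i. (fst w i, snd w (\<rho> i))) m)) \<partial>?N)"
  proof -
    have "(\<integral>w. (\<Sum>m\<in>S. \<Sum>\<rho> | \<rho> permutes S.
        of_bool (record_event A S (\<lambda>i. (fst w i, snd w (\<rho> i))) m)) \<partial>?N) =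
      (\<Sum>m\<in>S. \<integral>w. (\<Sum>\<rho> | \<rho> permutes S.
        of_bool (record_event A S (\<lambda>i. (fst w i, snd w (\<rho> i))) m) :: real) \<partial>?N)"
      by (intro Bochner_Integration.integral_sum Bochner_Integration.integrable_sum int) simp_all
    also have "\<dots> = (\<Sum>m\<in>S. \<Sum>\<rho> | \<rho> permutes S.
        \<integral>w. of_bool (record_event A S (\<lambda>i. (fst w i, snd w (\<rho> i))) m) \<partial>?N)"
      by (intro sum.cong refl Bochner_Integration.integral_sum int) simp_all
    finally show ?thesis ..
  qed
  also have "\<dots> = (\<integral>w. fact (card S) * record_avg (card S) (indicat_real A) \<partial>?N)"
  proof (rule integral_cong_AE)
    show "AE w in ?N. (\<Sum>m\<in>S. \<Sum>\<rho> | \<rho> permutes S.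
        of_bool (record_event A S (\<lambda>i. (fst w i, snd w (\<rho> i))) m)) =
        fact (card S) * record_avg (card S) (indicat_real A)"
      using AE by eventually_elim (simp add: sum_record_event_shuffled[OF fin])
  qed (use int in \<open>auto intro!: borel_measurable_sum borel_measurable_integrable\<close>)
  also have "\<dots> = fact (card S) * record_avg (card S) (indicat_real A)"
    by (simp add: N.prob_space)
  finally have "real (card S) * p = record_avg (card S) (indicat_real A)"
    by simp
  moreover have "card S \<noteq> 0" using fin n by auto
  ultimately show ?thesis unfolding p_def[symmetric] by (simp add: field_simps)
qed

section \<open>The conditional law of the number of broken records\<close>

text \<open>
  A record that is current at time \<open>n - 1\<close> but not at time \<open>n\<close> is dominated by the \<open>n\<close>-th
  observation, since nothing else has changed.
\<close>
lemma record_event_iff_record_breaks: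
  assumes "n \<ge> 1"
  shows "record_event A {1..n} x n \<longleftrightarrow> record_breaks x n \<ge> 0 \<and> nat (record_breaks x n) \<in> A"
proof -
  have irrefl: "\<not> p \<prec> p" for p by (simp add: precedes_def)
  have cases: "i \<in> {1..n} \<longleftrightarrow> i = n \<or> 1 \<le> i \<and> i < n" for i
    using assms by auto
  have rec: "sets_record x n \<longleftrightarrow> (\<forall>i\<in>{1..n}. \<not> x i \<prec> x n)"
    unfolding sets_record_def Ball_def cases using irrefl by blast
  have sub: "{1..n - 1} = {1..n} - {n}" using assms by auto
  have "current_record x (n - 1) j \<and> \<not> current_record x n j \<longleftrightarrow>
      x n \<prec> x j \<and> (\<forall>i\<in>{1..n} - {n}. \<not> x i \<prec> x j)" if "1 \<le> j" "j < n" for j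
    using that assms unfolding current_record_def sub by auto
  hence "broken_records x n = {j\<in>{1..n}. x n \<prec> x j \<and> (\<forall>i\<in>{1..n} - {n}. \<not> x i \<prec> x j)}"
    unfolding broken_records_def cases using irrefl by blast
  thus ?thesis
    unfolding record_event_def record_breaks_def rec by simp
qed

lemma finite_real_nat_le: "finite {k :: nat. real k \<le> x}"
proof (rule finite_subset)
  show "{k. real k \<le> x} \<subseteq> {..nat \<lfloor>x\<rfloor>}" by (auto simp: le_nat_floor)
qed simp

lemma cdf_shifted_geometric_half:
  "cdf (distr (measure_pmf geometric_half) borel (\<lambda>g. real g - 1)) x =
    (\<Sum>k | real k \<le> x. 1 / 2 ^ (k + 1))"
proof -
  have set: "{g. real g - 1 \<le> x} = {g. real g \<le> x + 1}" by auto
  have "cdf (distr (measure_pmf geometric_half) borel (\<lambda>g. real g - 1)) x =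
      measure (measure_pmf geometric_half) {g. real g - 1 \<le> x}"
    unfolding cdf_def by (subst measure_distr) (simp_all add: vimage_def)
  also have "\<dots> = (\<Sum>g | real g \<le> x + 1. pmf geometric_half g)"
    unfolding set by (rule measure_measure_pmf_finite[OF finite_real_nat_le])
  also have "\<dots> = (\<Sum>g\<in>Suc ` {k. real k \<le> x}. pmf geometric_half g)"
  proof (rule sum.mono_neutral_right[OF finite_real_nat_le])
    show "\<forall>g\<in>{g. real g \<le> x + 1} - Suc ` {k. real k \<le> x}. pmf geometric_half g = 0"
    proof
      fix g assume g: "g \<in> {g. real g \<le> x + 1} - Suc ` {k. real k \<le> x}"
      have "g = 0"
        using g by (cases g) auto
      thus "pmf geometric_half g = 0" by (simp add: pmf_geometric_half)
    qed
  qed auto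
  also have "\<dots> = (\<Sum>k | real k \<le> x. 1 / 2 ^ (k + 1))"
    by (simp add: sum.reindex pmf_geometric_half)
  finally show ?thesis .
qed

locale record_observations = prob_space M for M :: "'a measure" +
  fixes X :: "nat \<Rightarrow> 'a \<Rightarrow> real \<times> real" and K :: "nat \<Rightarrow> 'a \<Rightarrow> int"
  assumes indep: "indep_vars (\<lambda>_. borel) X {1..}"
    and uniform: "\<And>i. i \<ge> 1 \<Longrightarrow> distr M borel (X i) = uniform_measure lborel ({0<..<1} \<times> {0<..<1})"
    and K: "\<And>n \<omega>. K n \<omega> = record_breaks (\<lambda>i. X i \<omega>) n"
begin

lemma random_variable_X: "i \<ge> 1 \<Longrightarrow> random_variable borel (X i)"
  using indep unfolding indep_vars_def by auto

lemma K_ge: "K n \<omega> \<ge> -1"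
  by (simp add: K record_breaks_def)

lemma pred_K:
  assumes "n \<ge> 1"
  shows "Measurable.pred M (\<lambda>\<omega>. K n \<omega> \<ge> 0 \<and> nat (K n \<omega>) \<in> A)"
  unfolding K record_event_iff_record_breaks[OF assms, symmetric]
  using assms by (intro pred_record_event random_variable_X) auto

lemma prob_K:
  assumes n: "n \<ge> 1"
  shows "prob {\<omega> \<in> space M. K n \<omega> \<ge> 0 \<and> nat (K n \<omega>) \<in> A} = record_avg n (indicat_real A) / n"
proof -
  let ?S = "{1..n}"
  let ?B = "PiM ?S (\<lambda>_. borel) :: (nat \<Rightarrow> real \<times> real) measure"
  let ?X = "\<lambda>\<omega>. \<lambda>i\<in>?S. X i \<omega>"
  let ?P = "PiM ?S (\<lambda>_. unif \<Otimes>\<^sub>M unif)"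
  have rv: "random_variable borel (X i)" if "i \<in> ?S" for i
    using that by (intro random_variable_X) simp
  have "distr M ?B ?X = PiM ?S (\<lambda>i. distr M borel (X i))"
    using indep_vars_iff_distr_eq_PiM'[of ?S X "\<lambda>_. borel"] n rv indep_vars_subset[OF indep, of ?S]
    by auto
  also have "\<dots> = ?P"
    by (intro PiM_cong) (simp_all add: uniform uniform_square_eq_pair)
  finally have law: "distr M ?B ?X = ?P" .
  have X: "?X \<in> M \<rightarrow>\<^sub>M ?B" using rv by (intro measurable_restrict) auto
  have pred: "Measurable.pred ?B (\<lambda>x. record_event A ?S x n)"
    using n by (intro pred_record_event measurable_component_singleton) auto
  have space: "space ?P = space ?B" using arg_cong[OF law, of space] by simp
  have "record_avg n (indicat_real A) / n = measure ?P {x \<in> space ?P. record_event A ?S x n}"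
    using measure_record_event[of unif unif ?S n A] prob_space_unif emeasure_unif_singleton n by simp
  also have "\<dots> = measure (distr M ?B ?X) {x \<in> space ?B. record_event A ?S x n}"
    unfolding law space ..
  also have "\<dots> = prob (?X -` {x \<in> space ?B. record_event A ?S x n} \<inter> space M)"
    using pred by (intro measure_distr[OF X]) (simp add: pred_def)
  also have "?X -` {x \<in> space ?B. record_event A ?S x n} \<inter> space M =
      {\<omega> \<in> space M. K n \<omega> \<ge> 0 \<and> nat (K n \<omega>) \<in> A}"
  proof -
    have "record_event A ?S (?X \<omega>) n \<longleftrightarrow> record_event A ?S (\<lambda>i. X i \<omega>) n" for \<omega>
      using n by (intro record_event_cong) auto
    thus ?thesis
      unfolding K record_event_iff_record_breaks[OF n, symmetric]
      using measurable_space[OF X] by auto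
  qed
  finally show ?thesis by simp
qed

lemma prob_record:
  assumes "n \<ge> 1"
  shows "prob {\<omega> \<in> space M. K n \<omega> \<ge> 0} = harm n / n"
  using prob_K[OF assms, of UNIV] record_avg_one[of n] by (simp add: indicator_def)

text \<open>
  The factor \<open>1 / n\<close> that both probabilities share, coming from the choice of the last observation,
  cancels.
\<close>
lemma cond_prob_K:
  assumes n: "n \<ge> 1" and Q: "\<And>\<omega>. K n \<omega> \<ge> 0 \<Longrightarrow> Q (K n \<omega>) \<longleftrightarrow> nat (K n \<omega>) \<in> A"
  shows "\<P>(\<omega> in M. Q (K n \<omega>) \<bar> K n \<omega> \<ge> 0) = record_avg n (indicat_real A) / harm n"
proof -
  have "{\<omega> \<in> space M. Q (K n \<omega>) \<and> K n \<omega> \<ge> 0} = {\<omega> \<in> space M. K n \<omega> \<ge> 0 \<and> nat (K n \<omega>) \<in> A}"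
    using Q by blast
  thus ?thesis
    unfolding cond_prob_def using n by (simp add: prob_K prob_record)
qed

text \<open>
  On the event of no record, \<open>K n\<close> has the value \<open>-1\<close>, so that this event matters for \<open>x \<ge> -1\<close>.
\<close>
lemma pred_K_le:
  assumes n: "n \<ge> 1"
  shows "Measurable.pred M (\<lambda>\<omega>. real_of_int (K n \<omega>) \<le> x)"
proof -
  have "real_of_int (K n \<omega>) \<le> x \<longleftrightarrow> (K n \<omega> \<ge> 0 \<and> nat (K n \<omega>) \<in> {k. real k \<le> x})
      \<or> \<not> (K n \<omega> \<ge> 0 \<and> nat (K n \<omega>) \<in> UNIV) \<and> -1 \<le> x" for \<omega>
  proof (cases "K n \<omega> \<ge> 0")
    case False
    hence "K n \<omega> = -1" using K_ge[of n \<omega>] by linarith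
    thus ?thesis by simp
  qed simp
  thus ?thesis
    by (simp only:) (intro pred_intros_logic pred_K n; simp)
qed

lemma cdf_K:
  assumes n: "n \<ge> 1"
  shows "cdf (distr (uniform_measure M {\<omega> \<in> space M. K n \<omega> \<ge> 0}) borel (\<lambda>\<omega>. real_of_int (K n \<omega>))) x =
    record_avg n (indicat_real {k. real k \<le> x}) / harm n"
proof -
  have [measurable]: "Measurable.pred M (\<lambda>\<omega>. K n \<omega> \<ge> 0)"
    using pred_K[OF n, of UNIV] by simp
  have meas: "(\<lambda>\<omega>. real_of_int (K n \<omega>)) \<in> borel_measurable M"
    unfolding borel_measurable_iff_le using pred_K_le[OF n] by (simp add: pred_def)
  hence "cdf (distr (uniform_measure M {\<omega> \<in> space M. K n \<omega> \<ge> 0}) borel (\<lambda>\<omega>. real_of_int (K n \<omega>))) x =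
      measure (uniform_measure M {\<omega> \<in> space M. K n \<omega> \<ge> 0})
        {\<omega> \<in> space M. real_of_int (K n \<omega>) \<le> x}"
    unfolding cdf_def by (subst measure_distr) (auto intro!: arg_cong2[where f = measure])
  also have "\<dots> = \<P>(\<omega> in M. real_of_int (K n \<omega>) \<le> x \<bar> K n \<omega> \<ge> 0)"
    using measure_uniform_measure_eq_cond_prob[OF pred_K_le[OF n], of "\<lambda>\<omega>. K n \<omega> \<ge> 0"] by simp
  also have "\<dots> = record_avg n (indicat_real {k. real k \<le> x}) / harm n"
    by (rule cond_prob_K[OF n]) simp
  finally show ?thesis .
qed

text \<open>
  Given a record, all laws live on the nonnegative integers, so at each \<open>x\<close> the distribution function
  is a sum of the finitely many point masses at \<open>k \<le> x\<close>.
\<close>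
lemma weak_conv_K:
  "weak_conv_m
    (\<lambda>n. distr (uniform_measure M {\<omega> \<in> space M. K n \<omega> \<ge> 0}) borel (\<lambda>\<omega>. real_of_int (K n \<omega>)))
    (distr (measure_pmf geometric_half) borel (\<lambda>g. real g - 1))"
  unfolding weak_conv_m_def weak_conv_def cdf_shifted_geometric_half
  using record_avg_quotient_limit[OF cdf_K finite_real_nat_le] by blast

lemma cond_prob_K_limit:
  "(\<lambda>n. \<P>(\<omega> in M. K n \<omega> = int k \<bar> K n \<omega> \<ge> 0)) \<longlonglongrightarrow> 1 / 2 ^ (k + 1)"
proof -
  have "\<P>(\<omega> in M. K n \<omega> = int k \<bar> K n \<omega> \<ge> 0) = record_avg n (indicat_real {k}) / harm n"
    if "n \<ge> 1" for n
    using that by (rule cond_prob_K) auto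
  from record_avg_quotient_limit[OF this] show ?thesis by simp
qed

end

theorem theorem1p2:
  fixes M :: "'a measure"
    and X :: "nat \<Rightarrow> 'a \<Rightarrow> real \<times> real"
    and K :: "nat \<Rightarrow> 'a \<Rightarrow> int"
  assumes "prob_space M"
    and "prob_space.indep_vars M (\<lambda>_. borel) X {1..}"
    and "\<And>i. i \<ge> 1 \<Longrightarrow>
           distr M borel (X i) = uniform_measure lborel ({0<..<1} \<times> {0<..<1})"
    and "\<And>n \<omega>. K n \<omega> = record_breaks (\<lambda>i. X i \<omega>) n"
  shows "weak_conv_m
           (\<lambda>n. distr (uniform_measure M {\<omega> \<in> space M. K n \<omega> \<ge> 0}) borel (\<lambda>\<omega>. real_of_int (K n \<omega>)))
           (distr (measure_pmf geometric_half) borel (\<lambda>g. real g - 1))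
         \<and> (\<forall>k :: nat. (\<lambda>n. \<P>(\<omega> in M. K n \<omega> = int k \<bar> K n \<omega> \<ge> 0)) \<longlonglongrightarrow> 1 / 2 ^ (k + 1))"
proof -
  interpret prob_space M by fact
  interpret record_observations M X K
    by unfold_locales (fact assms)+
  show ?thesis using weak_conv_K cond_prob_K_limit by blast
qed

end
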